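(* Let $\boldsymbol{B}\in\mathbb{R}^{n\times n}$ be an index matrix. If $\boldsymbol{g}=(g_1,\ldots,g_n)'\in R_{\boldsymbol{B}}$, then, as $t\to\infty$, $$\boldsymbol{g}(tx)=x^{\boldsymbol{B}}\boldsymbol{g}(t)+o(g_n(t))$$ locally uniformly in $x\in(0,\infty)$ (that is, uniformly in $x$ on compact subsets of $(0,\infty)$).
   Context: Limit relations are as $t\to\infty$; measurability is Lebesgue. A real function is defined in a neighbourhood of infinity if its domain contains some $[t_0,\infty)$; it is eventually of constant sign if it is either strictly positive for all large $t$ or strictly negative for all large $t$. A rate vector of length $n$ is a column vector $\boldsymbol{g}=(g_1,\ldots,g_n)'$ of real-valued functions defined in a neighbourhood of infinity, each eventually of constant sign, with $g_{i+1}(t)=o(g_i(t))$ for every $i\in\{1,\ldots,n-1\}$; $o(g_n(t))$ means $o(|g_n(t)|)$, componentwise for vectors. For a square matrix $\boldsymbol{B}$ and $x>0$, $x^{\boldsymbol{B}}=\exp\{(\log x)\boldsymbol{B}\}$. An index matrix is an upper triangular $\boldsymbol{B}\in\mathbb{R}^{n\times n}$ whose diagonal elements are non-increasing and all of whose eigenvalues, except possibly the smallest one, have geometric multiplicity one. A rate vector $\boldsymbol{g}$ is regularly varying with index matrix $\boldsymbol{B}$, written $\boldsymbol{g}\in R_{\boldsymbol{B}}$, if $\boldsymbol{g}$ is measurable and $\boldsymbol{g}(xt)=x^{\boldsymbol{B}}\boldsymbol{g}(t)+o(g_n(t))$ for every (fixed) $x\in(0,\infty)$. *)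

theory Defs
  imports
    "HOL-Analysis.Analysis"
    "HOL-Library.Landau_Symbols"
    "Jordan_Normal_Form.Char_Poly"
    "Jordan_Normal_Form.Matrix_Kernel"
begin

(* Indices run over 0..n-1, so the last (smallest) rate g_n is g (n - 1). The component g i is a
   function on the set D i; its values outside D i carry no meaning. All matrices are square. *)

definition defined_near_infinity :: "real set \<Rightarrow> bool" where
  "defined_near_infinity S \<longleftrightarrow> (\<exists>t0. {t0..} \<subseteq> S)"

definition eventually_constant_sign :: "(real \<Rightarrow> real) \<Rightarrow> bool" where
  "eventually_constant_sign f \<longleftrightarrow>
     (\<forall>\<^sub>F t in at_top. 0 < f t) \<or> (\<forall>\<^sub>F t in at_top. f t < 0)"

definition rate_vector :: "nat \<Rightarrow> (nat \<Rightarrow> real set) \<Rightarrow> (nat \<Rightarrow> real \<Rightarrow> real) \<Rightarrow> bool" where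
  "rate_vector n D g \<longleftrightarrow>
     (\<forall>i<n. defined_near_infinity (D i) \<and> eventually_constant_sign (g i)) \<and>
     (\<forall>i. Suc i < n \<longrightarrow> g (Suc i) \<in> o[at_top](g i))"

definition value_vec :: "nat \<Rightarrow> (nat \<Rightarrow> real \<Rightarrow> real) \<Rightarrow> real \<Rightarrow> real Matrix.vec" where
  "value_vec n g t = Matrix.vec n (\<lambda>i. g i t)"

definition mat_exp :: "real mat \<Rightarrow> real mat" where
  "mat_exp A = Matrix.mat (dim_row A) (dim_row A) (\<lambda>(i, j). \<Sum>k. (A ^\<^sub>m k) $$ (i, j) / fact k)"

definition mat_powr :: "real \<Rightarrow> real mat \<Rightarrow> real mat" where
  "mat_powr x B = mat_exp (ln x \<cdot>\<^sub>m B)"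

(* char_matrix B ev is B - ev * I, so this is the dimension of the eigenspace of ev. *)
definition geometric_multiplicity :: "real mat \<Rightarrow> real \<Rightarrow> nat" where
  "geometric_multiplicity B ev = kernel_dim (char_matrix B ev)"

(* An upper triangular real matrix has only real eigenvalues, so it suffices to let the eigenvalues
   range over the reals. An eigenvalue is not the smallest one iff another one lies below it. *)
definition index_matrix :: "nat \<Rightarrow> real mat \<Rightarrow> bool" where
  "index_matrix n B \<longleftrightarrow>
     B \<in> carrier_mat n n \<and> upper_triangular B \<and>
     (\<forall>i j. i \<le> j \<longrightarrow> j < n \<longrightarrow> B $$ (j, j) \<le> B $$ (i, i)) \<and>
     (\<forall>ev. eigenvalue B ev \<longrightarrow> (\<exists>ev'. eigenvalue B ev' \<and> ev' < ev) \<longrightarrow>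
        geometric_multiplicity B ev = 1)"

definition regularly_varying ::
    "nat \<Rightarrow> real mat \<Rightarrow> (nat \<Rightarrow> real set) \<Rightarrow> (nat \<Rightarrow> real \<Rightarrow> real) \<Rightarrow> bool" where
  "regularly_varying n B D g \<longleftrightarrow>
     rate_vector n D g \<and>
     (\<forall>i<n. g i \<in> borel_measurable (lebesgue_on (D i))) \<and>
     (\<forall>x>0. \<forall>i<n.
        (\<lambda>t. g i (x * t) - (mat_powr x B *\<^sub>v value_vec n g t) $ i) \<in> o[at_top](g (n - 1)))"

end

theory Submission
  imports Defs
begin

text \<open>
  Write \<open>r(t, x) = g(t x) - x\<^sup>B g(t)\<close>. For every \<open>w > 0\<close>, the group property of \<open>x\<^sup>B\<close> gives
  \<open>r(t, y) = (y/w)\<^sup>B (r(t, w) - r(t y, w/y))\<close>. Hence \<open>r(t, y)\<close> is small as soon as a single \<open>w\<close> in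
  \<open>[1, 2]\<close> makes both remainders on the right small. As in the Csiszar-Erdos proof of the uniform
  convergence theorem, such a \<open>w\<close> exists for large \<open>t\<close>, uniformly in \<open>y\<close>, because pointwise
  convergence forces the exceptional sets to have small Lebesgue measure. The second remainder is
  small relative to \<open>g\<^sub>n(t y)\<close> rather than \<open>g\<^sub>n(t)\<close>; since \<open>B\<close> is upper triangular, \<open>g\<^sub>n\<close> is itself
  regularly varying, and comparing both values with \<open>g\<^sub>n(t w)\<close> bounds their ratio.
\<close>

section \<open>Matrix powers and the matrix exponential\<close>

lemma pow_mat_add:
  fixes A :: "'a::semiring_1 mat"
  assumes "A \<in> carrier_mat n n"
  shows "A ^\<^sub>m (p + q) = A ^\<^sub>m p * A ^\<^sub>m q"
proof (induction q)
  case 0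
  then show ?case using assms by simp
next
  case (Suc q)
  then show ?case
    using assms by (simp add: assoc_mult_mat[of _ n n _ n _ n])
qed

lemma pow_smult_mat:
  fixes A :: "'a::comm_semiring_1 mat"
  assumes "A \<in> carrier_mat n n"
  shows "(c \<cdot>\<^sub>m A) ^\<^sub>m k = c ^ k \<cdot>\<^sub>m A ^\<^sub>m k"
proof (induction k)
  case 0
  then show ?case using assms by (intro eq_matI) auto
next
  case (Suc k)
  have "(c \<cdot>\<^sub>m A) ^\<^sub>m Suc k = (c ^ k \<cdot>\<^sub>m A ^\<^sub>m k) * (c \<cdot>\<^sub>m A)"
    using Suc by simp
  also have "\<dots> = c \<cdot>\<^sub>m (c ^ k \<cdot>\<^sub>m (A ^\<^sub>m k * A))"
    using assms by (simp add: mult_smult_assoc_mat[of _ n n _ n] mult_smult_distrib[of _ n n _ n])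
  also have "\<dots> = c ^ Suc k \<cdot>\<^sub>m A ^\<^sub>m Suc k"
    using assms by (intro eq_matI) (auto simp: ac_simps)
  finally show ?case .
qed

lemma index_mult_mat_sum:
  assumes "A \<in> carrier_mat n m" "B \<in> carrier_mat m p" "i < n" "j < p"
  shows "(A * B) $$ (i, j) = (\<Sum>l<m. A $$ (i, l) * B $$ (l, j))"
  using assms by (auto simp: scalar_prod_def atLeast0LessThan intro!: sum.cong)

text \<open>The sum of all absolute entries dominates every absolute column sum, so each further
  factor \<open>A\<close> costs at most that sum. The induction fixes the row \<open>i\<close> but
  needs all entries of that row, hence the general \<open>j\<close>.\<close>

lemma abs_pow_mat_index_le:
  fixes A :: "real mat"
  assumes A: "A \<in> carrier_mat n n" and "i < n" "j < n"
  shows "\<bar>(A ^\<^sub>m k) $$ (i, j)\<bar> \<le> (\<Sum>i<n. \<Sum>j<n. \<bar>A $$ (i, j)\<bar>) ^ k"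
  using \<open>j < n\<close>
proof (induction k arbitrary: j)
  case 0
  then show ?case using assms by simp
next
  case (Suc k)
  let ?M = "\<Sum>i<n. \<Sum>j<n. \<bar>A $$ (i, j)\<bar>"
  have M0: "0 \<le> ?M" by (intro sum_nonneg) auto
  have "\<bar>(A ^\<^sub>m Suc k) $$ (i, j)\<bar> = \<bar>\<Sum>l<n. (A ^\<^sub>m k) $$ (i, l) * A $$ (l, j)\<bar>"
    using A \<open>i < n\<close> \<open>j < n\<close> by (simp add: index_mult_mat_sum[of _ n n _ n] del: index_mult_mat)
  also have "\<dots> \<le> (\<Sum>l<n. \<bar>(A ^\<^sub>m k) $$ (i, l) * A $$ (l, j)\<bar>)"
    by (rule sum_abs)
  also have "\<dots> \<le> (\<Sum>l<n. ?M ^ k * \<bar>A $$ (l, j)\<bar>)"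
    using Suc.IH by (intro sum_mono) (simp add: abs_mult mult_right_mono)
  also have "\<dots> = ?M ^ k * (\<Sum>l<n. \<bar>A $$ (l, j)\<bar>)"
    by (simp add: sum_distrib_left)
  also have "(\<Sum>l<n. \<bar>A $$ (l, j)\<bar>) \<le> ?M"
    using \<open>j < n\<close> by (intro sum_mono member_le_sum) auto
  then have "?M ^ k * (\<Sum>l<n. \<bar>A $$ (l, j)\<bar>) \<le> ?M ^ Suc k"
    using M0 by (simp add: mult_left_mono mult.commute[of ?M])
  finally show ?case .
qed

lemma mat_exp_carrier [simp, intro]: "A \<in> carrier_mat n n \<Longrightarrow> mat_exp A \<in> carrier_mat n n"
  by (auto simp: mat_exp_def)

lemma mat_exp_smult_index:
  assumes "A \<in> carrier_mat n n" "i < n" "j < n"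
  shows "mat_exp (v \<cdot>\<^sub>m A) $$ (i, j) = (\<Sum>k. v ^ k * (A ^\<^sub>m k) $$ (i, j) / fact k)"
  using assms by (simp add: mat_exp_def pow_smult_mat[of _ n])

lemma exp_summand_bound:
  fixes A :: "real mat"
  assumes "A \<in> carrier_mat n n" "i < n" "j < n"
  shows "\<bar>v ^ k * (A ^\<^sub>m k) $$ (i, j) / fact k\<bar>
    \<le> (\<bar>v\<bar> * (\<Sum>i<n. \<Sum>j<n. \<bar>A $$ (i, j)\<bar>)) ^ k / fact k"
  using abs_pow_mat_index_le[OF assms, of k]
  by (auto simp: abs_mult power_abs power_mult_distrib intro!: divide_right_mono mult_left_mono)

text \<open>Comparison with a scalar exponential series. The convergence is absolute, as the Cauchy
  product in \<open>mat_exp_add\<close> requires.\<close>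

lemma summable_mat_exp:
  fixes A :: "real mat"
  assumes "A \<in> carrier_mat n n" "i < n" "j < n"
  shows "summable (\<lambda>k. \<bar>v ^ k * (A ^\<^sub>m k) $$ (i, j) / fact k\<bar>)"
  by (rule summable_comparison_test[OF _ summable_exp[of "\<bar>v\<bar> * (\<Sum>i<n. \<Sum>j<n. \<bar>A $$ (i, j)\<bar>)"]])
    (use exp_summand_bound[OF assms] in \<open>auto simp: divide_simps\<close>)

lemma abs_mat_exp_smult_index_le:
  fixes A :: "real mat"
  assumes "A \<in> carrier_mat n n" "i < n" "j < n"
  shows "\<bar>mat_exp (v \<cdot>\<^sub>m A) $$ (i, j)\<bar> \<le> exp (\<bar>v\<bar> * (\<Sum>i<n. \<Sum>j<n. \<bar>A $$ (i, j)\<bar>))"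
proof -
  let ?x = "\<bar>v\<bar> * (\<Sum>i<n. \<Sum>j<n. \<bar>A $$ (i, j)\<bar>)"
  have "\<bar>mat_exp (v \<cdot>\<^sub>m A) $$ (i, j)\<bar> \<le> (\<Sum>k. \<bar>v ^ k * (A ^\<^sub>m k) $$ (i, j) / fact k\<bar>)"
    unfolding mat_exp_smult_index[OF assms] by (rule summable_rabs[OF summable_mat_exp[OF assms]])
  also have "\<dots> \<le> (\<Sum>k. ?x ^ k / fact k)"
    using summable_exp[of ?x]
    by (intro suminf_le summable_mat_exp[OF assms] exp_summand_bound[OF assms])
      (simp add: divide_inverse mult.commute)
  also have "\<dots> = exp ?x"
    by (simp add: exp_def divide_inverse mult.commute)
  finally show ?thesis .
qed

lemma mat_exp_zero:
  assumes "A \<in> carrier_mat n n"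
  shows "mat_exp (0 \<cdot>\<^sub>m A) = 1\<^sub>m n"
proof (rule eq_matI)
  fix i j assume ij: "i < dim_row (1\<^sub>m n :: real mat)" "j < dim_col (1\<^sub>m n :: real mat)"
  \<comment> \<open>Since \<open>0 ^ 0 = 1\<close>, exactly the term \<open>k = 0\<close>
    survives.\<close>
  have "(\<Sum>k. 0 ^ k * (A ^\<^sub>m k) $$ (i, j) / fact k)
      = (\<Sum>k\<in>{0}. 0 ^ k * (A ^\<^sub>m k) $$ (i, j) / fact k)"
    by (rule suminf_finite) auto
  then show "mat_exp (0 \<cdot>\<^sub>m A) $$ (i, j) = 1\<^sub>m n $$ (i, j)"
    using ij assms by (simp add: mat_exp_smult_index[OF assms])
qed (use assms in \<open>auto simp: mat_exp_def\<close>)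

text \<open>Entrywise Cauchy product followed by the binomial theorem; no commutation issue arises
  because only powers of the single matrix \<open>A\<close> are multiplied.\<close>

lemma mat_exp_add:
  assumes A: "A \<in> carrier_mat n n"
  shows "mat_exp ((u + v) \<cdot>\<^sub>m A) = mat_exp (u \<cdot>\<^sub>m A) * mat_exp (v \<cdot>\<^sub>m A)"
proof (rule eq_matI)
  fix i j assume "i < dim_row (mat_exp (u \<cdot>\<^sub>m A) * mat_exp (v \<cdot>\<^sub>m A))"
    "j < dim_col (mat_exp (u \<cdot>\<^sub>m A) * mat_exp (v \<cdot>\<^sub>m A))"
  then have ij: "i < n" "j < n" using A by (auto simp: mat_exp_def)
  define a where "a = (\<lambda>u i j k. u ^ k * (A ^\<^sub>m k) $$ (i, j) / fact k)"
  have "(\<lambda>k. \<Sum>p\<le>k. a u i l p * a v l j (k - p)) sums ((\<Sum>k. a u i l k) * (\<Sum>k. a v l j k))"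
    if "l < n" for l
    unfolding a_def using ij that A by (intro Cauchy_product_sums) (simp_all only: real_norm_def summable_mat_exp)
  then have "(\<lambda>k. \<Sum>l<n. \<Sum>p\<le>k. a u i l p * a v l j (k - p)) sums
      (\<Sum>l<n. (\<Sum>k. a u i l k) * (\<Sum>k. a v l j k))"
    by (intro sums_sum) auto
  moreover have "(\<Sum>l<n. \<Sum>p\<le>k. a u i l p * a v l j (k - p)) = a (u + v) i j k" for k
  proof -
    have "(\<Sum>l<n. \<Sum>p\<le>k. a u i l p * a v l j (k - p))
        = (\<Sum>p\<le>k. \<Sum>l<n. a u i l p * a v l j (k - p))"
      by (rule sum.swap)
    \<comment> \<open>With the sum over \<open>l\<close> innermost, it is an entry of
      \<open>A ^\<^sub>m p * A ^\<^sub>m (k - p)\<close>, which does not depend on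
      \<open>p\<close>.\<close>
    also have "\<dots> = (\<Sum>p\<le>k. u ^ p * v ^ (k - p) / (fact p * fact (k - p))
        * (\<Sum>l<n. (A ^\<^sub>m p) $$ (i, l) * (A ^\<^sub>m (k - p)) $$ (l, j)))"
      by (simp add: a_def sum_distrib_left field_simps)
    also have "\<dots> = (\<Sum>p\<le>k. u ^ p * v ^ (k - p) / (fact p * fact (k - p)) * (A ^\<^sub>m k) $$ (i, j))"
    proof (intro sum.cong refl arg_cong2[where f = "(*)"])
      fix p assume "p \<in> {..k}"
      then have "A ^\<^sub>m k = A ^\<^sub>m p * A ^\<^sub>m (k - p)"
        using pow_mat_add[OF A, of p "k - p"] by simp
      then show "(\<Sum>l<n. (A ^\<^sub>m p) $$ (i, l) * (A ^\<^sub>m (k - p)) $$ (l, j)) = (A ^\<^sub>m k) $$ (i, j)"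
        using A ij by (simp add: index_mult_mat_sum[of _ n n _ n] del: index_mult_mat)
    qed
    also have "\<dots> = (\<Sum>p\<le>k. of_nat (k choose p) * u ^ p * v ^ (k - p)) * (A ^\<^sub>m k) $$ (i, j) / fact k"
      unfolding sum_distrib_right sum_divide_distrib
      by (intro sum.cong) (auto simp: binomial_fact)
    also have "\<dots> = a (u + v) i j k"
      by (simp add: a_def binomial_ring)
    finally show ?thesis .
  qed
  ultimately have "(\<Sum>k. a (u + v) i j k) = (\<Sum>l<n. (\<Sum>k. a u i l k) * (\<Sum>k. a v l j k))"
    by (simp add: sums_iff)
  then show "mat_exp ((u + v) \<cdot>\<^sub>m A) $$ (i, j) = (mat_exp (u \<cdot>\<^sub>m A) * mat_exp (v \<cdot>\<^sub>m A)) $$ (i, j)"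
    using A ij
    by (simp add: index_mult_mat_sum[of _ n n _ n] mat_exp_smult_index[OF A] a_def del: index_mult_mat)
qed (use A in \<open>auto simp: mat_exp_def\<close>)

text \<open>The last row of an upper triangular matrix vanishes off the diagonal, so only
  \<open>l = m\<close> contributes to each product. Through the exponential this makes the smallest
  rate satisfy a scalar relation of its own.\<close>

lemma pow_mat_last_row:
  fixes A :: "'a::comm_semiring_1 mat"
  assumes A: "A \<in> carrier_mat (Suc m) (Suc m)" "upper_triangular A" and "j \<le> m"
  shows "(A ^\<^sub>m k) $$ (m, j) = (if j = m then A $$ (m, m) ^ k else 0)"
  using \<open>j \<le> m\<close>
proof (induction k arbitrary: j)
  case 0
  then show ?case using A by simp
next
  case (Suc k)
  have "(A ^\<^sub>m Suc k) $$ (m, j) = (\<Sum>l<Suc m. (A ^\<^sub>m k) $$ (m, l) * A $$ (l, j))"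
    using A Suc.prems
    by (simp add: index_mult_mat_sum[of _ "Suc m" "Suc m" _ "Suc m"] del: index_mult_mat)
  also have "\<dots> = A $$ (m, m) ^ k * A $$ (m, j)"
    using Suc.IH by simp
  also have "\<dots> = (if j = m then A $$ (m, m) ^ Suc k else 0)"
    using A Suc.prems by (auto simp: upper_triangular_def mult.commute)
  finally show ?case .
qed

lemma mat_exp_last_row:
  assumes A: "A \<in> carrier_mat (Suc m) (Suc m)" "upper_triangular A" and "j \<le> m"
  shows "mat_exp (v \<cdot>\<^sub>m A) $$ (m, j) = (if j = m then exp (v * A $$ (m, m)) else 0)"
  using assms
  by (simp add: mat_exp_smult_index[OF A(1)] pow_mat_last_row exp_def power_mult_distrib
      divide_inverse mult.commute)

section \<open>Convergence in measure and a common good point\<close>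

text \<open>Dominated convergence for the indicators of the exceptional sets; the majorant 1 is
  integrable because the measure is finite.\<close>

lemma (in finite_measure) measure_abs_ge_tendsto_zero:
  fixes f :: "nat \<Rightarrow> 'a \<Rightarrow> real"
  assumes [measurable]: "\<And>k. f k \<in> borel_measurable M"
    and lim: "\<And>x. x \<in> space M \<Longrightarrow> (\<lambda>k. f k x) \<longlonglongrightarrow> 0" and "0 < e"
  shows "(\<lambda>k. measure M {x \<in> space M. e \<le> \<bar>f k x\<bar>}) \<longlonglongrightarrow> 0"
proof -
  let ?S = "\<lambda>k. {x \<in> space M. e \<le> \<bar>f k x\<bar>}"
  have "(\<lambda>k. integral\<^sup>L M (indicator (?S k) :: 'a \<Rightarrow> real)) \<longlonglongrightarrow> integral\<^sup>L M (\<lambda>_. 0)"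
  proof (rule integral_dominated_convergence[where w = "\<lambda>_. 1"])
    show "AE x in M. (\<lambda>k. indicator (?S k) x :: real) \<longlonglongrightarrow> 0"
    proof (rule AE_I2)
      fix x assume "x \<in> space M"
      then have "\<forall>\<^sub>F k in sequentially. \<bar>f k x\<bar> < e"
        using lim[of x] \<open>0 < e\<close> by (auto simp: tendsto_iff dist_real_def)
      then have "\<forall>\<^sub>F k in sequentially. indicator (?S k) x = (0 :: real)"
        by eventually_elim auto
      then show "(\<lambda>k. indicator (?S k) x :: real) \<longlonglongrightarrow> 0"
        by (rule tendsto_eventually)
    qed
  qed (auto simp: indicator_def)
  then show ?thesis by simp
qed

lemma measure_lebesgue_image_mult:
  "measure lebesgue ((\<lambda>x. c * x) ` S) = \<bar>c\<bar> * measure lebesgue (S :: real set)"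
  using measure_lebesgue_affine[of c 0 S] by simp

text \<open>For fixed \<open>y\<close>, both exceptional sets of \<open>w\<close> have small measure, so they cannot cover \<open>{1..2}\<close>.\<close>

lemma eventually_common_good_point:
  fixes \<phi> :: "real \<Rightarrow> real \<Rightarrow> real"
  assumes lim: "\<And>x. 0 < x \<Longrightarrow> ((\<lambda>t. \<phi> t x) \<longlongrightarrow> 0) at_top"
    and meas: "\<And>a b. 0 < a \<Longrightarrow> \<forall>\<^sub>F t in at_top. \<phi> t \<in> borel_measurable (lebesgue_on {a..b})"
    and "0 < a" "0 < e"
  shows "\<forall>\<^sub>F t in at_top. \<forall>y\<in>{a..b}. \<exists>w\<in>{1..2}. \<bar>\<phi> t w\<bar> < e \<and> \<bar>\<phi> (t * y) (w / y)\<bar> < e"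
proof (rule ccontr)
  assume contra: "\<not> ?thesis"
  \<comment> \<open>\<open>?J\<close> contains every quotient \<open>w / y\<close> with
    \<open>w\<close> in \<open>?I\<close> and \<open>y\<close> in \<open>{a..b}\<close>.\<close>
  let ?I = "{1..2::real}" and ?J = "{1 / b..2 / a}"
  define bad where "bad = (\<lambda>t y. y \<in> {a..b} \<and>
    (\<forall>w\<in>?I. e \<le> \<bar>\<phi> t w\<bar> \<or> e \<le> \<bar>\<phi> (t * y) (w / y)\<bar>))"
  have ex: "\<exists>t\<ge>s. \<exists>y. bad t y" for s
    using contra unfolding eventually_at_top_linorder bad_def not_less[symmetric] by blast
  then have "a \<le> b" by (force simp: bad_def)
  with \<open>0 < a\<close> have "0 < b" by simp
  obtain T1 where T1: "\<And>t. T1 \<le> t \<Longrightarrow> \<phi> t \<in> borel_measurable (lebesgue_on ?I)"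
    using meas[of 1 2] by (auto simp: eventually_at_top_linorder)
  obtain T2 where T2: "\<And>t. T2 \<le> t \<Longrightarrow> \<phi> t \<in> borel_measurable (lebesgue_on ?J)"
    using meas[of "1 / b" "2 / a"] \<open>0 < b\<close> by (auto simp: eventually_at_top_linorder)
  \<comment> \<open>Dominated convergence works along sequences, so bad pairs are picked with
    \<open>t\<close> tending to infinity. \<open>T1\<close> and \<open>T2 / a\<close> guarantee
    measurability at base points \<open>t k\<close> and \<open>t k * y k\<close>.\<close>
  have "\<forall>k. \<exists>t y. max 0 (max T1 (max (T2 / a) (real k))) \<le> t \<and> bad t y"
    using ex by blast
  then obtain t y where ty: "\<And>k. max 0 (max T1 (max (T2 / a) (real k))) \<le> t k" "\<And>k. bad (t k) (y k)"
    by metis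
  have y: "a \<le> y k" "y k \<le> b" "0 < y k" for k
    using ty(2)[of k] \<open>0 < a\<close> by (auto simp: bad_def)
  have t0: "0 \<le> t k" for k
    using ty(1)[of k] by simp
  have lim_t: "filterlim t at_top sequentially"
    by (rule filterlim_at_top_mono[OF filterlim_real_sequentially]) (use ty(1) in auto)
  have ta: "t k * a \<le> t k * y k" for k
    using y(1) t0 by (intro mult_left_mono) auto
  have lim_ty: "filterlim (\<lambda>k. t k * y k) at_top sequentially"
  proof (rule filterlim_at_top_mono)
    show "filterlim (\<lambda>k. t k * a) at_top sequentially"
      using lim_t \<open>0 < a\<close> by (simp add: filterlim_tendsto_pos_mult_at_top[OF tendsto_const] mult.commute)
  qed (use ta in auto)
  have T2_le: "T2 \<le> t k * y k" for k
  proof -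
    have "T2 / a \<le> t k" using ty(1)[of k] by simp
    then have "T2 \<le> t k * a" using \<open>0 < a\<close> by (simp add: pos_divide_le_eq)
    with ta[of k] show ?thesis by linarith
  qed
  \<comment> \<open>\<open>V\<close> is written in the variable \<open>v = w / y k\<close>, so that
    it lies in an interval independent of \<open>k\<close>; dilation by \<open>y k\<close> leads
    back to \<open>w\<close>.\<close>
  define U where "U = (\<lambda>k. {w \<in> ?I. e \<le> \<bar>\<phi> (t k) w\<bar>})"
  define V where "V = (\<lambda>k. {v \<in> ?J. e \<le> \<bar>\<phi> (t k * y k) v\<bar>})"
  interpret I: finite_measure "lebesgue_on ?I"
    by (rule finite_measure_lebesgue_on) auto
  interpret J: finite_measure "lebesgue_on ?J"
    by (rule finite_measure_lebesgue_on) auto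
  have mU: "\<phi> (t k) \<in> borel_measurable (lebesgue_on ?I)" for k
    using ty(1)[of k] by (intro T1) simp
  have mV: "\<phi> (t k * y k) \<in> borel_measurable (lebesgue_on ?J)" for k
    using T2_le by (rule T2)
  have U_eq: "U k = {w \<in> space (lebesgue_on ?I). e \<le> \<bar>\<phi> (t k) w\<bar>}" for k
    by (auto simp: U_def)
  have V_eq: "V k = {w \<in> space (lebesgue_on ?J). e \<le> \<bar>\<phi> (t k * y k) w\<bar>}" for k
    by (auto simp: V_def)
  have "U k \<in> sets (lebesgue_on ?I)" for k
    unfolding U_eq using mU by measurable
  then have U_sets: "U k \<in> sets lebesgue" for k
    by (rule sets_restrict_space_subset[THEN subsetD, rotated]) auto
  have "V k \<in> sets (lebesgue_on ?J)" for k
    unfolding V_eq using mV by measurable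
  then have V_sets: "V k \<in> sets lebesgue" for k
    by (rule sets_restrict_space_subset[THEN subsetD, rotated]) auto
  have U_lm: "U k \<in> lmeasurable" for k
    by (rule bounded_set_imp_lmeasurable[OF bounded_subset[of ?I] U_sets]) (auto simp: U_def)
  have "(\<lambda>k. measure (lebesgue_on ?I) (U k)) \<longlonglongrightarrow> 0"
    unfolding U_eq using lim_t \<open>0 < e\<close>
    by (intro I.measure_abs_ge_tendsto_zero mU filterlim_compose[OF lim]) auto
  moreover have "(\<lambda>k. measure (lebesgue_on ?J) (V k)) \<longlonglongrightarrow> 0"
    unfolding V_eq using lim_ty \<open>0 < e\<close> \<open>0 < a\<close> \<open>0 < b\<close>
    by (intro J.measure_abs_ge_tendsto_zero mV filterlim_compose[OF lim]) (auto intro: less_le_trans[of 0 "1 / b"])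
  moreover have "measure (lebesgue_on ?I) (U k) = measure lebesgue (U k)" for k
    by (rule measure_restrict_space) (auto simp: U_def)
  moreover have "measure (lebesgue_on ?J) (V k) = measure lebesgue (V k)" for k
    by (rule measure_restrict_space) (auto simp: V_def)
  ultimately have "(\<lambda>k. measure lebesgue (U k) + b * measure lebesgue (V k)) \<longlonglongrightarrow> 0 + b * 0"
    by (intro tendsto_intros) auto
  \<comment> \<open>Badness of \<open>y k\<close> means that \<open>U k\<close> and the dilate of
    \<open>V k\<close> cover \<open>?I\<close>, of measure 1; the dilation multiplies measure by
    \<open>y k\<close>, at most \<open>b\<close>.\<close>
  moreover have "1 \<le> measure lebesgue (U k) + b * measure lebesgue (V k)" for k
  proof -
    let ?V = "(\<lambda>x. y k * x) ` V k"
    have V': "?V \<in> lmeasurable"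
    proof (rule bounded_set_imp_lmeasurable)
      \<comment> \<open>Measurability of the image follows by viewing it as a preimage under the
        inverse scaling.\<close>
      have "?V = (*\<^sub>R) (1 / y k) -` V k"
        using y(3)[of k] by (force simp: image_iff)
      then show "?V \<in> sets lebesgue"
        using measurable_sets[OF lebesgue_measurable_scaling V_sets, of "1 / y k" k] by simp
      have "bounded (V k)"
        by (rule bounded_subset[of ?J]) (auto simp: V_def)
      then show "bounded ?V"
        using bounded_scaling[of "V k" "y k"] by simp
    qed
    have "?I \<subseteq> U k \<union> ?V"
    proof
      fix w assume w: "w \<in> ?I"
      then consider "e \<le> \<bar>\<phi> (t k) w\<bar>" | "e \<le> \<bar>\<phi> (t k * y k) (w / y k)\<bar>"
        using ty(2)[of k] w unfolding bad_def by blast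
      then show "w \<in> U k \<union> ?V"
      proof cases
        case 2
        have "w / y k \<in> ?J"
          using w y[of k] \<open>0 < a\<close> by (auto intro!: frac_le)
        with 2 have "w / y k \<in> V k" by (simp add: V_def)
        moreover have "w = y k * (w / y k)" using y(3)[of k] by simp
        ultimately show ?thesis by blast
      qed (use w in \<open>simp add: U_def\<close>)
    qed
    then have "measure lebesgue ?I \<le> measure lebesgue (U k \<union> ?V)"
      by (rule measure_mono_fmeasurable) (use U_lm V' in auto)
    also have "\<dots> \<le> measure lebesgue (U k) + measure lebesgue ?V"
      using U_sets V' by (intro measure_Un_le) auto
    also have "\<dots> = measure lebesgue (U k) + y k * measure lebesgue (V k)"
      using y(3)[of k] by (simp add: measure_lebesgue_image_mult)
    also have "\<dots> \<le> measure lebesgue (U k) + b * measure lebesgue (V k)"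
      using y(2) by (intro add_left_mono mult_right_mono) auto
    finally show ?thesis by simp
  qed
  ultimately have "1 \<le> 0 + b * 0"
    by (intro LIMSEQ_le_const) auto
  then show False by simp
qed

section \<open>The remainder: algebra, bounds and measurability\<close>

definition remainder :: "nat \<Rightarrow> real mat \<Rightarrow> (nat \<Rightarrow> real \<Rightarrow> real) \<Rightarrow> real \<Rightarrow> real \<Rightarrow> real Matrix.vec" where
  "remainder n B g t x = value_vec n g (t * x) - mat_powr x B *\<^sub>v value_vec n g t"

lemma value_vec_carrier [simp, intro]: "value_vec n g t \<in> carrier_vec n"
  by (simp add: value_vec_def)

lemma mat_powr_carrier [simp, intro]: "B \<in> carrier_mat n n \<Longrightarrow> mat_powr x B \<in> carrier_mat n n"
  by (simp add: mat_powr_def)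

lemma remainder_carrier [simp, intro]: "B \<in> carrier_mat n n \<Longrightarrow> remainder n B g t x \<in> carrier_vec n"
  using carrier_matD(1)[OF mat_powr_carrier[of B n x]] by (intro carrier_vecI) (simp add: remainder_def)

lemma remainder_index:
  assumes "B \<in> carrier_mat n n" "i < n"
  shows "remainder n B g t x $ i = g i (t * x) - (mat_powr x B *\<^sub>v value_vec n g t) $ i"
  using mat_powr_carrier[OF assms(1), of x] assms(2) by (simp add: remainder_def value_vec_def)

lemma mat_powr_mult:
  assumes "B \<in> carrier_mat n n" "0 < x" "0 < y"
  shows "mat_powr (x * y) B = mat_powr x B * mat_powr y B"
  using assms by (simp add: mat_powr_def ln_mult mat_exp_add)

lemma mat_powr_one: "B \<in> carrier_mat n n \<Longrightarrow> mat_powr 1 B = 1\<^sub>m n"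
  by (simp add: mat_powr_def mat_exp_zero)

lemma mat_mult_vec_index_sum:
  assumes "A \<in> carrier_mat m n" "v \<in> carrier_vec n" "i < m"
  shows "(A *\<^sub>v v) $ i = (\<Sum>j<n. A $$ (i, j) * v $ j)"
  using assms by (auto simp: scalar_prod_def atLeast0LessThan intro!: sum.cong)

text \<open>Expand \<open>g\<close> at \<open>t * w\<close> once from base \<open>t\<close> and once
  from base \<open>t * y\<close>. In the difference of the two remainders this value cancels, and
  multiplying by the power of \<open>y / w\<close> leaves the remainder at \<open>y\<close>. The
  point \<open>w\<close> is free.\<close>

lemma remainder_eq:
  assumes B: "B \<in> carrier_mat n n" and "0 < w" "0 < y"
  shows "remainder n B g t y
    = mat_powr (y / w) B *\<^sub>v (remainder n B g t w - remainder n B g (t * y) (w / y))"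
proof -
  let ?P = "\<lambda>x. mat_powr x B" and ?v = "value_vec n g"
  have P: "?P x \<in> carrier_mat n n" for x
    using B by simp
  have Pv: "?P x *\<^sub>v ?v s \<in> carrier_vec n" for x s
    using P by (meson mult_mat_vec_carrier value_vec_carrier)
  have "t * y * (w / y) = t * w"
    using \<open>0 < y\<close> by simp
  then have "remainder n B g t w - remainder n B g (t * y) (w / y)
      = ?P (w / y) *\<^sub>v ?v (t * y) - ?P w *\<^sub>v ?v t"
    unfolding remainder_def using P[of w] P[of "w / y"]
    by (intro eq_vecI) (auto simp: value_vec_def)
  then have "?P (y / w) *\<^sub>v (remainder n B g t w - remainder n B g (t * y) (w / y))
      = ?P (y / w) *\<^sub>v (?P (w / y) *\<^sub>v ?v (t * y)) - ?P (y / w) *\<^sub>v (?P w *\<^sub>v ?v t)"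
    using mult_minus_distrib_mat_vec[OF P Pv Pv] by simp
  also have "\<dots> = (?P (y / w) * ?P (w / y)) *\<^sub>v ?v (t * y) - (?P (y / w) * ?P w) *\<^sub>v ?v t"
    using assoc_mult_mat_vec[OF P P value_vec_carrier] by simp
  also have "\<dots> = ?P 1 *\<^sub>v ?v (t * y) - ?P y *\<^sub>v ?v t"
    using mat_powr_mult[OF B, of "y / w" "w / y"] mat_powr_mult[OF B, of "y / w" w] assms by simp
  also have "\<dots> = remainder n B g t y"
    using mat_powr_one[OF B] by (simp add: remainder_def)
  finally show ?thesis ..
qed

lemma remainder_last:
  assumes "B \<in> carrier_mat (Suc m) (Suc m)" "upper_triangular B" "0 < x"
  shows "remainder (Suc m) B g t x $ m = g m (t * x) - x powr (B $$ (m, m)) * g m t"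
proof -
  have "(mat_powr x B *\<^sub>v value_vec (Suc m) g t) $ m
      = (\<Sum>j<Suc m. mat_powr x B $$ (m, j) * value_vec (Suc m) g t $ j)"
    using assms by (intro mat_mult_vec_index_sum) auto
  also have "\<dots> = x powr (B $$ (m, m)) * g m t"
    using assms by (simp add: mat_powr_def mat_exp_last_row value_vec_def powr_def mult.commute)
  finally show ?thesis
    using assms(1) by (simp add: remainder_index)
qed

lemma borel_measurable_mat_powr_index:
  assumes "B \<in> carrier_mat n n" "i < n" "j < n"
  shows "(\<lambda>x. mat_powr x B $$ (i, j)) \<in> borel_measurable borel"
  using assms by (simp add: mat_powr_def mat_exp_smult_index)

text \<open>On the interval, \<open>ln x\<close> lies between \<open>ln p\<close> and
  \<open>ln q\<close>, so the exponential bound on the entries becomes uniform.\<close>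

lemma mat_powr_index_bound:
  assumes B: "B \<in> carrier_mat n n" and "0 < p"
  obtains M where "1 \<le> M" "\<And>x i j. \<lbrakk>p \<le> x; x \<le> q; i < n; j < n\<rbrakk> \<Longrightarrow> \<bar>mat_powr x B $$ (i, j)\<bar> \<le> M"
proof
  let ?S = "\<Sum>i<n. \<Sum>j<n. \<bar>B $$ (i, j)\<bar>"
  let ?M = "exp ((\<bar>ln p\<bar> + \<bar>ln q\<bar>) * ?S)"
  have S: "0 \<le> ?S" by (intro sum_nonneg) auto
  then show "1 \<le> ?M" by simp
  fix x i j assume x: "p \<le> x" "x \<le> q" and ij: "i < n" "j < n"
  have "ln p \<le> ln x" "ln x \<le> ln q"
    using x \<open>0 < p\<close> by auto
  then have "\<bar>ln x\<bar> * ?S \<le> (\<bar>ln p\<bar> + \<bar>ln q\<bar>) * ?S"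
    using S by (intro mult_right_mono) auto
  then have "exp (\<bar>ln x\<bar> * ?S) \<le> ?M"
    by (simp only: exp_le_cancel_iff)
  with abs_mat_exp_smult_index_le[OF B ij, of "ln x"] show "\<bar>mat_powr x B $$ (i, j)\<bar> \<le> ?M"
    unfolding mat_powr_def by (rule order.trans)
qed

text \<open>Truncate \<open>f\<close> to zero below \<open>T\<close>, compose with the scaling by
  \<open>t\<close>, and restrict. The truncation is invisible on \<open>{a..b}\<close> because
  \<open>T \<le> t * a\<close>, so the values of \<open>f\<close> off \<open>D\<close> never
  enter.\<close>

lemma borel_measurable_dilation:
  fixes f :: "real \<Rightarrow> real"
  assumes f: "f \<in> borel_measurable (lebesgue_on D)" and D: "{T..} \<subseteq> D" and "0 < t" "T \<le> t * a"
  shows "(\<lambda>x. f (t * x)) \<in> borel_measurable (lebesgue_on {a..b})"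
proof -
  have "f \<in> borel_measurable (lebesgue_on {T..})"
    using f D by (rule measurable_restrict_mono)
  then have "(\<lambda>x. if x \<in> {T..} then f x else 0) \<in> borel_measurable lebesgue"
    by (rule borel_measurable_if_I) auto
  from measurable_compose[OF lebesgue_measurable_scaling[of t] this]
  have "(\<lambda>x. if t * x \<in> {T..} then f (t * x) else 0) \<in> borel_measurable (lebesgue_on {a..b})"
    by (intro measurable_restrict_space1) (simp cong: if_cong)
  moreover have "t * x \<in> {T..}" if "x \<in> {a..b}" for x
  proof -
    have "t * a \<le> t * x" using that \<open>0 < t\<close> by simp
    with \<open>T \<le> t * a\<close> show ?thesis by simp
  qed
  ultimately show ?thesis
    by (subst (asm) measurable_lebesgue_cong[where g = "\<lambda>x. f (t * x)"]) auto
qed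

text \<open>The matrix part is a power series in \<open>ln x\<close>, hence Borel. The claim holds
  for large \<open>t\<close> only, once \<open>t * a\<close> has reached the half-line where
  \<open>g i\<close> is defined.\<close>

lemma borel_measurable_remainder:
  assumes B: "B \<in> carrier_mat n n" and "0 < a" "i < n"
    and f: "g i \<in> borel_measurable (lebesgue_on (D i))" and D: "defined_near_infinity (D i)"
  shows "\<forall>\<^sub>F t in at_top. (\<lambda>x. remainder n B g t x $ i) \<in> borel_measurable (lebesgue_on {a..b})"
proof -
  obtain T where T: "{T..} \<subseteq> D i"
    using D by (auto simp: defined_near_infinity_def)
  show ?thesis
    using eventually_gt_at_top[of 0] eventually_ge_at_top[of "T / a"]
  proof eventually_elim
    case (elim t)
    then have "T \<le> t * a" using \<open>0 < a\<close> by (simp add: pos_divide_le_eq)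
    then have m1: "(\<lambda>x. g i (t * x)) \<in> borel_measurable (lebesgue_on {a..b})"
      using borel_measurable_dilation[OF f T] elim by blast
    have "(\<lambda>x. \<Sum>j<n. mat_powr x B $$ (i, j) * g j t) \<in> borel_measurable borel"
      using borel_measurable_mat_powr_index[OF B \<open>i < n\<close>]
      by (intro borel_measurable_sum borel_measurable_times) auto
    then have "(\<lambda>x. \<Sum>j<n. mat_powr x B $$ (i, j) * g j t) \<in> borel_measurable (lebesgue_on {a..b})"
      by (intro measurable_restrict_space1 measurable_completion) simp
    moreover have "remainder n B g t x $ i
        = g i (t * x) - (\<Sum>j<n. mat_powr x B $$ (i, j) * g j t)" for x
      unfolding remainder_index[OF B \<open>i < n\<close>] using B \<open>i < n\<close>
      by (subst mat_mult_vec_index_sum[of _ n n]) (auto simp: value_vec_def)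
    ultimately show ?case using m1 by simp
  qed
qed

section \<open>The uniform estimate on compact sets\<close>

theorem theorem4p1:
  fixes n :: nat and B :: "real mat"
    and D :: "nat \<Rightarrow> real set" and g :: "nat \<Rightarrow> real \<Rightarrow> real"
  assumes "n \<ge> 1"
    and "index_matrix n B"
    and "regularly_varying n B D g"
  shows "\<forall>K. compact K \<and> K \<subseteq> {0<..} \<longrightarrow>
           (\<forall>i<n. \<forall>c>0. \<forall>\<^sub>F t in at_top. \<forall>x\<in>K.
              \<bar>g i (t * x) - (mat_powr x B *\<^sub>v value_vec n g t) $ i\<bar> \<le> c * \<bar>g (n - 1) t\<bar>)"
proof (intro allI impI, elim conjE)
  fix K :: "real set" and i and c :: real
  assume K: "compact K" "K \<subseteq> {0<..}" and i: "i < n" and c: "0 < c"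
  obtain m where n: "n = Suc m" using \<open>n \<ge> 1\<close> by (cases n) auto
  have B: "B \<in> carrier_mat n n" and ut: "upper_triangular B"
    using assms(2) by (auto simp: index_matrix_def)
  have rv: "\<And>i. i < n \<Longrightarrow> defined_near_infinity (D i)"
    "\<And>i. i < n \<Longrightarrow> g i \<in> borel_measurable (lebesgue_on (D i))"
    "\<And>i. i < n \<Longrightarrow> eventually_constant_sign (g i)"
    "\<And>x i. 0 < x \<Longrightarrow> i < n \<Longrightarrow>
      (\<lambda>t. g i (x * t) - (mat_powr x B *\<^sub>v value_vec n g t) $ i) \<in> o[at_top](g (n - 1))"
    using assms(3) by (auto simp: regularly_varying_def rate_vector_def)
  have gm: "g (n - Suc 0) = g m" by (simp add: n)
  let ?r = "remainder n B g"
  obtain a b where ab: "0 < a" "a \<le> b" "K \<subseteq> {a..b}"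
  proof (cases "K = {}")
    case True
    then show ?thesis using that[of 1 1] by simp
  next
    case False
    with K obtain s u where "s \<in> K" "u \<in> K" "\<forall>x\<in>K. s \<le> x" "\<forall>x\<in>K. x \<le> u"
      using compact_attains_inf compact_attains_sup by metis
    then show ?thesis using K that[of s u] by force
  qed
  then have b: "0 < b" by simp

  \<comment> \<open>Summing over the components gives one scalar function, so that a single
    \<open>w\<close> serves all components at once.\<close>
  define \<phi> where "\<phi> = (\<lambda>t x. \<Sum>j<n. \<bar>?r t x $ j / g m t\<bar>)"
  have lim: "((\<lambda>t. \<phi> t x) \<longlongrightarrow> 0) at_top" if "0 < x" for x
    unfolding \<phi>_def
  proof (rule tendsto_null_sum)
    fix j assume "j \<in> {..<n}"
    then have "(\<lambda>t. ?r t x $ j) \<in> o[at_top](g m)"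
      using rv(4)[OF that, of j] by (simp add: gm remainder_index[OF B] mult.commute)
    then show "((\<lambda>t. \<bar>?r t x $ j / g m t\<bar>) \<longlongrightarrow> 0) at_top"
      by (intro tendsto_rabs_zero smalloD_tendsto)
  qed
  have meas: "\<forall>\<^sub>F t in at_top. \<phi> t \<in> borel_measurable (lebesgue_on {p..q})" if "0 < p" for p q
  proof -
    have "\<forall>\<^sub>F t in at_top. \<forall>j\<in>{..<n}. (\<lambda>x. ?r t x $ j) \<in> borel_measurable (lebesgue_on {p..q})"
      using that rv by (intro eventually_ball_finite) (auto intro!: borel_measurable_remainder[OF B])
    then show ?thesis
      unfolding \<phi>_def
      by eventually_elim
        (intro borel_measurable_sum borel_measurable_abs borel_measurable_divide, auto)
  qed
  \<comment> \<open>A quotient by zero is 0, so smallness of \<open>\<phi>\<close> bounds the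
    remainder only where \<open>g m\<close> does not vanish.\<close>
  have "\<forall>\<^sub>F t in at_top. g m t \<noteq> 0"
    using rv(3)[of m] n by (auto simp: eventually_constant_sign_def elim: eventually_mono)
  then obtain T where T: "\<And>t. T \<le> t \<Longrightarrow> g m t \<noteq> 0"
    by (auto simp: eventually_at_top_linorder)

  \<comment> \<open>The interval from \<open>p\<close> to \<open>q\<close> contains the ranges of
    \<open>w\<close>, \<open>w / y\<close> and \<open>y / w\<close> for \<open>w\<close> in
    \<open>{1..2}\<close> and \<open>y\<close> in \<open>{a..b}\<close>.\<close>
  define p where "p = Min {1, 1 / b, a / 2}"
  define q where "q = Max {2, 2 / a, b}"
  have "0 < p" using ab b by (simp add: p_def)
  then obtain M where M: "1 \<le> M"
    "\<And>x i j. \<lbrakk>p \<le> x; x \<le> q; i < n; j < n\<rbrakk> \<Longrightarrow> \<bar>mat_powr x B $$ (i, j)\<bar> \<le> M"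
    using mat_powr_index_bound[OF B] by metis
  have powr_le: "x powr (B $$ (m, m)) \<le> M" if "p \<le> x" "x \<le> q" for x
    using M(2)[OF that, of m m] that \<open>0 < p\<close> B ut
    by (simp add: n mat_powr_def mat_exp_last_row powr_def mult.commute)
  \<comment> \<open>\<open>C\<close> will bound the ratio of \<open>g m (t * y)\<close> to
    \<open>g m t\<close>. The first entry of \<open>e\<close> keeps \<open>1 / M - e\<close> at
    least \<open>1 / (2 * M)\<close>; the second absorbs the final matrix-vector product into
    \<open>c\<close>.\<close>
  define C where "C = 2 * M * (M + 1)"
  define e where "e = min (1 / (2 * M)) (c / (n * (M * (1 + C))))"
  have "0 \<le> C" using M(1) by (simp add: C_def)
  then have e: "0 < e" "e \<le> 1 / (2 * M)" "e \<le> c / (n * (M * (1 + C)))"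
    using M(1) c n by (auto simp: e_def)
  have "1 / (2 * M) \<le> 1"
    using M(1) by simp
  with e have "e \<le> 1" by linarith
  have r_le: "\<bar>?r s x $ j\<bar> \<le> e * \<bar>g m s\<bar>" if "\<bar>\<phi> s x\<bar> < e" "T \<le> s" "j < n" for s x j
  proof -
    have "\<bar>?r s x $ j / g m s\<bar> \<le> \<phi> s x"
      unfolding \<phi>_def using that(3) by (intro member_le_sum) auto
    with that have "\<bar>?r s x $ j\<bar> / \<bar>g m s\<bar> \<le> e" by simp
    then show ?thesis using T[OF that(2)] by (simp add: pos_divide_le_eq)
  qed

  have "\<forall>\<^sub>F t in at_top. \<forall>y\<in>{a..b}. \<exists>w\<in>{1..2}. \<bar>\<phi> t w\<bar> < e \<and> \<bar>\<phi> (t * y) (w / y)\<bar> < e"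
    using lim meas ab(1) e(1) by (rule eventually_common_good_point)
  then show "\<forall>\<^sub>F t in at_top. \<forall>x\<in>K.
      \<bar>g i (t * x) - (mat_powr x B *\<^sub>v value_vec n g t) $ i\<bar> \<le> c * \<bar>g (n - 1) t\<bar>"
    \<comment> \<open>The second threshold gives \<open>T \<le> t * y\<close> for all
      \<open>y\<close> in \<open>{a..b}\<close>, so \<open>g m\<close> is nonzero at both base
      points.\<close>
    using eventually_ge_at_top[of T] eventually_ge_at_top[of "T / a"] eventually_ge_at_top[of 0]
  proof eventually_elim
    case (elim t)
    show ?case
    proof
      fix y assume "y \<in> K"
      with ab have y: "a \<le> y" "y \<le> b" "0 < y" by force+
      then obtain w where w: "1 \<le> w" "w \<le> 2" "\<bar>\<phi> t w\<bar> < e" "\<bar>\<phi> (t * y) (w / y)\<bar> < e"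
        using elim(1) unfolding atLeastAtMost_iff Ball_def Bex_def by blast
      have "T \<le> t * a" using elim(3) ab(1) by (simp add: pos_divide_le_eq)
      moreover have "t * a \<le> t * y" using y elim(4) by (intro mult_left_mono) auto
      ultimately have Ty: "T \<le> t * y" by linarith
      have r1: "\<bar>?r t w $ j\<bar> \<le> e * \<bar>g m t\<bar>" if "j < n" for j
        using r_le[OF w(3) elim(2) that] .
      have r2: "\<bar>?r (t * y) (w / y) $ j\<bar> \<le> e * \<bar>g m (t * y)\<bar>" if "j < n" for j
        using r_le[OF w(4) Ty that] .
      have "p \<le> a / 2" "b \<le> q" by (simp_all add: p_def q_def)
      moreover have "a / 2 \<le> y / w" using w y by (intro frac_le) auto
      moreover have "y / w \<le> b / 1" using w y by (intro frac_le) auto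
      ultimately have yw: "p \<le> y / w" "y / w \<le> q" by linarith+
      have wq: "p \<le> w" "w \<le> q"
        using w by (auto simp: p_def q_def min_def max_def)

      let ?d = "B $$ (m, m)"
      have "1 / M \<le> (w / y) powr ?d"
      proof -
        have "(w / y) powr ?d = 1 / (y / w) powr ?d"
          using w y by (simp add: powr_divide)
        moreover have "0 < (y / w) powr ?d" using w y by simp
        ultimately show ?thesis
          using powr_le[OF yw] by (simp add: frac_le)
      qed
      then have "1 / (2 * M) \<le> (w / y) powr ?d - e"
        using e(2) by (simp add: field_simps)
      \<comment> \<open>Both values of \<open>g m\<close> are compared with
        \<open>g m (t * w)\<close>: from base \<open>t * y\<close> it is bounded below by the
        reverse triangle inequality, from base \<open>t\<close> it is bounded above.\<close>
      then have "1 / (2 * M) * \<bar>g m (t * y)\<bar> \<le> ((w / y) powr ?d - e) * \<bar>g m (t * y)\<bar>"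
        by (rule mult_right_mono) simp
      also have "\<dots> \<le> \<bar>g m (t * w)\<bar>"
      proof -
        have "g m (t * w) = (w / y) powr ?d * g m (t * y) + ?r (t * y) (w / y) $ m"
          using remainder_last[OF B[unfolded n] ut, of "w / y" g "t * y"] w y by (simp add: n)
        moreover have "\<bar>(w / y) powr ?d * g m (t * y)\<bar> = (w / y) powr ?d * \<bar>g m (t * y)\<bar>"
          by (simp add: abs_mult)
        ultimately show ?thesis
          using r2[of m] n by (simp add: left_diff_distrib)
      qed
      also have "\<dots> \<le> (M + 1) * \<bar>g m t\<bar>"
      proof -
        have "g m (t * w) = w powr ?d * g m t + ?r t w $ m"
          using remainder_last[OF B[unfolded n] ut, of w g t] w by (simp add: n)
        moreover have "\<bar>w powr ?d * g m t\<bar> \<le> M * \<bar>g m t\<bar>"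
          using powr_le[OF wq] by (simp add: abs_mult mult_right_mono)
        moreover have "e * \<bar>g m t\<bar> \<le> 1 * \<bar>g m t\<bar>"
          using \<open>e \<le> 1\<close> by (rule mult_right_mono) simp
        ultimately show ?thesis
          using r1[of m] n by (simp add: distrib_right)
      qed
      finally have g_ty: "\<bar>g m (t * y)\<bar> \<le> C * \<bar>g m t\<bar>"
        using M(1) by (simp add: C_def field_simps)

      let ?u = "?r t w - ?r (t * y) (w / y)"
      \<comment> \<open>The ratio bound turns the second remainder, small relative to
        \<open>g m (t * y)\<close>, into one small relative to \<open>g m t\<close>.\<close>
      have u: "\<bar>?u $ j\<bar> \<le> e * (1 + C) * \<bar>g m t\<bar>" if "j < n" for j
      proof -
        have "\<bar>?u $ j\<bar> \<le> \<bar>?r t w $ j\<bar> + \<bar>?r (t * y) (w / y) $ j\<bar>"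
          using that remainder_carrier[OF B, of g "t * y" "w / y"] by simp
        also have "\<dots> \<le> e * \<bar>g m t\<bar> + e * (C * \<bar>g m t\<bar>)"
          using r1[OF that] r2[OF that] g_ty e(1)
          by (meson add_mono less_imp_le mult_left_mono order.trans)
        finally show ?thesis by (simp add: algebra_simps)
      qed
      have "?r t y $ i = (mat_powr (y / w) B *\<^sub>v ?u) $ i"
        using w y remainder_eq[OF B, of w y g t] by simp
      also have "\<dots> = (\<Sum>j<n. mat_powr (y / w) B $$ (i, j) * ?u $ j)"
        using B i by (intro mat_mult_vec_index_sum) auto
      finally have "\<bar>?r t y $ i\<bar> \<le> (\<Sum>j<n. \<bar>mat_powr (y / w) B $$ (i, j) * ?u $ j\<bar>)"
        using sum_abs by metis
      also have "\<dots> \<le> (\<Sum>j<n. M * (e * (1 + C) * \<bar>g m t\<bar>))"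
        using M(2)[OF yw i] u M(1) unfolding abs_mult by (intro sum_mono mult_mono) auto
      also have "\<dots> = e * (n * (M * (1 + C))) * \<bar>g m t\<bar>"
        by simp
      also have "\<dots> \<le> c * \<bar>g m t\<bar>"
      proof (rule mult_right_mono)
        have "0 < real n * (M * (1 + C))" using n M(1) \<open>0 \<le> C\<close> by simp
        then show "e * (n * (M * (1 + C))) \<le> c" using e(3) by (simp only: pos_le_divide_eq)
      qed simp
      finally show "\<bar>g i (t * y) - (mat_powr y B *\<^sub>v value_vec n g t) $ i\<bar> \<le> c * \<bar>g (n - 1) t\<bar>"
        by (simp add: gm remainder_index[OF B i])
    qed
  qed
qed

end
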